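(* Let $a>b>0$ be real numbers, and set $$\mathbf{K}_{+}^{(a,b)}=\mathbf{K}\left(\frac{\sqrt{a}+\sqrt{b}}{\sqrt{2(a+b)}}\right),\qquad \mathbf{K}_{-}^{(a,b)}=\mathbf{K}\left(\frac{\sqrt{a}-\sqrt{b}}{\sqrt{2(a+b)}}\right).$$ Then $$\frac{\mathbf{K}_{+}^{(a,b)}}{\mathbf{K}_{-}^{(a,b)}}=\frac{\frac{\sqrt{b}}{2}\,\mathrm{F}_{D}^{(3)}\left(\tfrac12;\tfrac12;2\,\middle|\,\tfrac12,\tfrac{b}{a+b},\tfrac{b}{b-a}\right)+\sqrt{a}\,\mathrm{F}_{D}^{(3)}\left(\tfrac12;\tfrac12;1\,\middle|\,\tfrac12,\tfrac{b}{a+b},\tfrac{b}{b-a}\right)}{\sqrt{a}\,\mathrm{F}_{D}^{(3)}\left(\tfrac12;\tfrac12;1\,\middle|\,\tfrac12,\tfrac{b}{a+b},\tfrac{b}{b-a}\right)-\frac{\sqrt{b}}{2}\,\mathrm{F}_{D}^{(3)}\left(\tfrac12;\tfrac12;2\,\middle|\,\tfrac12,\tfrac{b}{a+b},\tfrac{b}{b-a}\right)}$$ and $$\frac{\mathbf{K}_{+}^{(a,b)}}{\mathbf{K}_{-}^{(a,b)}}=\frac{2\sqrt{a(a+b)}\,\mathrm{F}_{D}^{(3)}\left(\tfrac12;\tfrac12;1\,\middle|\,-1,\tfrac{b}{a},-\tfrac{b}{a}\right)+\sqrt{b(a+b)}\,\mathrm{F}_{D}^{(3)}\left(\tfrac3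2;\tfrac12;2\,\middle|\,-1,\tfrac{b}{a},-\tfrac{b}{a}\right)}{2\sqrt{a(a+b)}\,\mathrm{F}_{D}^{(3)}\left(\tfrac12;\tfrac12;1\,\middle|\,-1,\tfrac{b}{a},-\tfrac{b}{a}\right)-\sqrt{b(a+b)}\,\mathrm{F}_{D}^{(3)}\left(\tfrac32;\tfrac12;2\,\middle|\,-1,\tfrac{b}{a},-\tfrac{b}{a}\right)}.$$
   Context: For $|k|<1$, $\mathbf{K}(k)=\int_{0}^{1}\frac{\mathrm{d}u}{\sqrt{(1-u^{2})(1-k^{2}u^{2})}}$ is the complete elliptic integral of the first kind with modulus $k$. Lauricella function with equal $b$-parameters: for real $\alpha,\beta,\gamma$ with $\gamma>\alpha>0$ and $x_1,x_2,x_3\in\mathbb{C}\setminus[1,\infty)$, $\mathrm{F}_{D}^{(3)}(\alpha;\beta;\gamma\,|\,x_1,x_2,x_3)$ denotes the Lauricella function with parameters $b_1=b_2=b_3=\beta$, given by the integral representation $$\mathrm{F}_{D}^{(3)}(\alpha;\beta;\gamma\,|\,x_1,x_2,x_3)=\frac{\Gamma(\gamma)}{\Gamma(\alpha)\Gamma(\gamma-\alpha)}\int_0^1\frac{u^{\alpha-1}(1-u)^{\gamma-\alpha-1}}{(1-x_1u)^{\beta}(1-x_2u)^{\beta}(1-x_3u)^{\beta}}\,\mathrm{d}u$$ (principal branches). It is the analytic continuation of the series $\sum_{m_1,m_2,m_3\ge0}\frac{(\alpha)_{m_1+m_2+m_3}(\beta)_{m_1}(\beta)_{m_2}(\beta)_{m_3}}{(\gamma)_{m_1+m_2+m_3}\,m_1!\,m_2!\,m_3!}x_1^{m_1}x_2^{m_2}x_3^{m_3}$,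 which converges for $|x_j|<1$, where $(\lambda)_m=\lambda(\lambda+1)\cdots(\lambda+m-1)$. *)

theory Defs
  imports "HOL-Analysis.Analysis"
begin

text \<open>
  The modulus (not the parameter \<open>k\<^sup>2\<close>) is the argument; meaningful for \<open>\<bar>k\<bar> < 1\<close>.
  The integral is improper at \<open>u = 1\<close>, where the integrand takes the irrelevant value
  \<open>1 / 0 = 0\<close>.
\<close>

definition elliptic_K :: "real \<Rightarrow> real" where
  "elliptic_K k = integral {0..1} (\<lambda>u. 1 / sqrt ((1 - u\<^sup>2) * (1 - k\<^sup>2 * u\<^sup>2)))"

definition K_plus :: "real \<Rightarrow> real \<Rightarrow> real" where
  "K_plus a b = elliptic_K ((sqrt a + sqrt b) / sqrt (2 * (a + b)))"

definition K_minus :: "real \<Rightarrow> real \<Rightarrow> real" where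
  "K_minus a b = elliptic_K ((sqrt a - sqrt b) / sqrt (2 * (a + b)))"

text \<open>
  Meaningful for \<open>\<gamma> > \<alpha> > 0\<close> and no \<open>x\<^sub>j\<close> in the real ray \<open>[1, \<infinity>)\<close>. The powers of
  \<open>1 - x\<^sub>j u\<close> are complex, so \<open>powr\<close> is the principal branch there. The values of the
  integrand at the end points \<open>u = 0\<close> and \<open>u = 1\<close> are irrelevant.
\<close>

definition Lauricella_FD3 ::
    "real \<Rightarrow> real \<Rightarrow> real \<Rightarrow> complex \<Rightarrow> complex \<Rightarrow> complex \<Rightarrow> complex" where
  "Lauricella_FD3 \<alpha> \<beta> \<gamma> x\<^sub>1 x\<^sub>2 x\<^sub>3 =
     complex_of_real (Gamma \<gamma> / (Gamma \<alpha> * Gamma (\<gamma> - \<alpha>))) *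
     integral {0..1} (\<lambda>u::real.
       complex_of_real (u powr (\<alpha> - 1) * (1 - u) powr (\<gamma> - \<alpha> - 1)) /
       ((1 - x\<^sub>1 * complex_of_real u) powr complex_of_real \<beta> *
        (1 - x\<^sub>2 * complex_of_real u) powr complex_of_real \<beta> *
        (1 - x\<^sub>3 * complex_of_real u) powr complex_of_real \<beta>))"

end

theory Submission
  imports Defs
begin

text \<open>
  Put \<open>r = b/a\<close>, \<open>c = \<surd>r\<close> and \<open>J\<^sub>n = \<integral>\<^sub>0\<^sup>1 v\<^sup>n dv / \<surd>(v(1 - v\<^sup>2)(1 - r\<^sup>2v\<^sup>2))\<close>. All four Lauricella
  integrals are multiples of \<open>J\<^sub>0\<close> or \<open>J\<^sub>1\<close>: those at \<open>(-1, r, -r)\<close> directly, the other two after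
  \<open>u = 1 - v\<close>. Both quotients thereby reduce to \<open>(J\<^sub>0 + c J\<^sub>1) / (J\<^sub>0 - c J\<^sub>1)\<close>. The genus 2 curve
  underlying \<open>J\<^sub>n\<close> has the involution \<open>v \<mapsto> 1/(rv)\<close>, and \<open>J\<^sub>0 \<plusminus> c J\<^sub>1\<close> are the periods of the two
  elliptic quotients: \<open>s = 1/\<surd>v \<mp> c \<surd>v\<close>, invariant up to sign, turns them into complete elliptic
  integrals with the same constant factor. One substitution valid for all \<open>-1 < c < 1\<close> covers both signs.
\<close>

section \<open>Complete elliptic integrals as integrals on a genus 2 curve\<close>

definition J_den :: "real \<Rightarrow> real \<Rightarrow> real" where
  "J_den r v = sqrt (v * (1 - v\<^sup>2) * (1 - r\<^sup>2 * v\<^sup>2))"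

text \<open>The only singularity is that of \<open>1 / sqrt (1 - u\<^sup>2)\<close> at
  \<open>u = 1\<close>, with primitive \<open>arcsin\<close>; the other factor stays bounded because
  \<open>k\<^sup>2 < 1\<close>. The change of variables below asks for this absolute
  integrability.\<close>

lemma absolutely_integrable_elliptic_K:
  fixes k :: real
  assumes "k\<^sup>2 < 1"
  shows "(\<lambda>u. 1 / sqrt ((1 - u\<^sup>2) * (1 - k\<^sup>2 * u\<^sup>2))) absolutely_integrable_on {0<..<1}"
proof -
  have "((\<lambda>u. 1 / sqrt (1 - u\<^sup>2)) has_integral (arcsin 1 - arcsin 0)) {0..1}"
  proof (rule fundamental_theorem_of_calculus_interior)
    show "continuous_on {0..1} arcsin"
      by (rule continuous_on_subset[OF continuous_on_arcsin']) auto
    show "(arcsin has_vector_derivative 1 / sqrt (1 - u\<^sup>2)) (at u)" if "u \<in> {0<..<1}" for u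
      using that DERIV_arcsin[of u]
      by (simp add: has_real_derivative_iff_has_vector_derivative inverse_eq_divide)
  qed simp
  then have "(\<lambda>u::real. 1 / sqrt (1 - u\<^sup>2)) integrable_on {0<..<1}"
    by (auto simp: has_integral_Icc_iff_Ioo integrable_on_def)
  then have arcsin': "(\<lambda>u::real. 1 / sqrt (1 - u\<^sup>2)) absolutely_integrable_on {0<..<1}"
    by (rule nonnegative_absolutely_integrable_1) (simp add: power_le_one)
  have pos: "1 - k\<^sup>2 * u\<^sup>2 \<ge> 1 - k\<^sup>2" if "u \<in> {0<..<1}" for u
    using that mult_left_le[of "u\<^sup>2" "k\<^sup>2"] by (simp add: power_le_one)
  have "(\<lambda>u. 1 / sqrt (1 - k\<^sup>2 * u\<^sup>2) * (1 / sqrt (1 - u\<^sup>2))) absolutely_integrable_on {0<..<1}"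
  proof (rule absolutely_integrable_bounded_measurable_product_real)
    have "continuous_on {0<..<1} (\<lambda>u. 1 / sqrt (1 - k\<^sup>2 * u\<^sup>2))"
      by (intro continuous_intros) (use pos assms in fastforce)
    then show "(\<lambda>u. 1 / sqrt (1 - k\<^sup>2 * u\<^sup>2)) \<in> borel_measurable (lebesgue_on {0<..<1})"
      by (intro continuous_imp_measurable_on_sets_lebesgue) auto
    have "\<bar>1 / sqrt (1 - k\<^sup>2 * u\<^sup>2)\<bar> \<le> 1 / sqrt (1 - k\<^sup>2)" if "u \<in> {0<..<1}" for u
      using pos[OF that] assms by (simp add: frac_le)
    then show "bounded ((\<lambda>u. 1 / sqrt (1 - k\<^sup>2 * u\<^sup>2)) ` {0<..<1})"
      by (intro boundedI[where B = "1 / sqrt (1 - k\<^sup>2)"]) auto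
  qed (use arcsin' in auto)
  then show ?thesis
    by (simp add: real_sqrt_mult mult.commute)
qed

text \<open>With \<open>c = sqrt r\<close> the modulus is that of \<open>K_plus\<close>, with
  \<open>c = - sqrt r\<close> that of \<open>K_minus\<close>, while \<open>J_den\<close> sees only
  \<open>c\<^sup>2\<close>.\<close>

lemma elliptic_K_quintic:
  fixes c :: real
  assumes "\<bar>c\<bar> < 1"
  defines "k \<equiv> (1 + c) / sqrt (2 * (1 + c\<^sup>2))"
  shows "((\<lambda>v. (1 + c * v) / J_den (c\<^sup>2) v) has_integral
           2 / sqrt (2 * (1 + c\<^sup>2)) * elliptic_K k) {0<..<1}"
proof -
  \<comment> \<open>In terms of \<open>s = (1 - c v) / \<surd>v\<close>, which is \<open>1 - c\<close> at \<open>v = 1\<close>, the substitution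
    \<open>u = \<surd>(w v)\<close> reads \<open>u\<^sup>2 = 1 - (1 - c)\<^sup>2 / s\<^sup>2\<close>.\<close>
  define f where "f u = 1 / sqrt ((1 - u\<^sup>2) * (1 - k\<^sup>2 * u\<^sup>2))" for u :: real
  define w where "w v = (1 - v) * (1 - c\<^sup>2 * v) / (1 - c * v)\<^sup>2" for v
  define w' where "w' v = - ((1 - c)\<^sup>2 * (1 + c * v) / (1 - c * v) ^ 3)" for v
  define g where "g v = sqrt (w v)" for v
  define g' where "g' v = w' v / (2 * sqrt (w v))" for v
  define m where "m = sqrt (2 * (1 + c\<^sup>2))"
  have c2: "c\<^sup>2 < 1"
    using assms(1) by (simp add: abs_square_less_1)
  have cv: "\<bar>c * v\<bar> < 1" if "v \<in> {0..1}" for v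
    using mult_left_le[of v "\<bar>c\<bar>"] that assms(1) by (auto simp: abs_mult)
  have c2v: "c\<^sup>2 * v < 1" if "v \<in> {0..1}" for v
    using mult_left_le[of v "c\<^sup>2"] that c2 by auto
  have m: "m > 0" "m\<^sup>2 = 2 * (1 + c\<^sup>2)"
    by (simp_all add: m_def add_pos_nonneg)
  have k2: "k\<^sup>2 = (1 + c)\<^sup>2 / (2 * (1 + c\<^sup>2))"
    using m by (simp add: k_def m_def power_divide)
  \<comment> \<open>The point is
    \<open>1 - k\<^sup>2 = (1 - c)\<^sup>2 / (2 * (1 + c\<^sup>2))\<close>.\<close>
  have "(1 - c)\<^sup>2 > 0"
    using assms(1) by auto
  then have k1: "k\<^sup>2 < 1"
    unfolding k2 by (simp add: power2_eq_square algebra_simps add_pos_nonneg)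
  have one_minus_w: "1 - w v = (1 - c)\<^sup>2 * v / (1 - c * v)\<^sup>2" if "v \<in> {0..1}" for v
  proof -
    have "(1 - c)\<^sup>2 * v = (1 - c * v)\<^sup>2 - (1 - v) * (1 - c\<^sup>2 * v)"
      by (simp add: power2_eq_square algebra_simps)
    then show ?thesis
      using cv[OF that] by (simp add: w_def diff_divide_distrib)
  qed
  have w_pos: "w v > 0" "w v < 1" if "v \<in> {0<..<1}" for v
  proof -
    show "w v > 0"
      using that c2v[of v] cv[of v] by (simp add: w_def)
    have "1 - w v > 0"
      using that assms(1) cv[of v] by (simp add: one_minus_w)
    then show "w v < 1" by simp
  qed
  have der: "(g has_field_derivative g' v) (at v within {0<..<1})" if "v \<in> {0<..<1}" for v
  proof -
    define h where "h = 1 - c * v"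
    have "h \<noteq> 0"
      using cv[of v] that by (auto simp: h_def)
    then have "(w has_field_derivative
        ((- (1 - c\<^sup>2 * v) - c\<^sup>2 * (1 - v)) * h\<^sup>2 + (1 - v) * (1 - c\<^sup>2 * v) * (2 * c * h)) / (h\<^sup>2 * h\<^sup>2)) (at v)"
      unfolding w_def h_def by (auto intro!: derivative_eq_intros simp: algebra_simps)
    \<comment> \<open>One factor \<open>h\<close> splits off. The remaining factor
      \<open>1 + c * v\<close> is the numerator of the target integrand.\<close>
    also have "(- (1 - c\<^sup>2 * v) - c\<^sup>2 * (1 - v)) * h\<^sup>2 + (1 - v) * (1 - c\<^sup>2 * v) * (2 * c * h)
        = - ((1 - c)\<^sup>2 * (1 + c * v)) * h"
      by (simp add: h_def power2_eq_square algebra_simps)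
    also have "\<dots> / (h\<^sup>2 * h\<^sup>2) = w' v"
      using \<open>h \<noteq> 0\<close> unfolding w'_def h_def[symmetric]
      by (simp add: divide_simps) (simp add: power2_eq_square power3_eq_cube power4_eq_xxxx)
    finally have "(w has_field_derivative w' v) (at v)" .
    from DERIV_chain2[where f = sqrt and g = w, OF DERIV_real_sqrt[OF w_pos(1)[OF that]] this] show ?thesis
      unfolding g_def g'_def
      by (auto intro: DERIV_subset simp: field_simps)
  qed
  have inj: "inj_on g {0<..<1}"
  proof (rule inj_onI)
    fix x y assume x: "x \<in> {0<..<1}" and y: "y \<in> {0<..<1}" and "g x = g y"
    then have "(1 - c)\<^sup>2 * x / (1 - c * x)\<^sup>2 = (1 - c)\<^sup>2 * y / (1 - c * y)\<^sup>2"
      using one_minus_w[of x] one_minus_w[of y] x y by (simp add: g_def)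
    moreover have "c \<noteq> 1" "c * x \<noteq> 1" "c * y \<noteq> 1"
      using x y cv[of x] cv[of y] assms(1) by auto
    ultimately have "x * (1 - c * y)\<^sup>2 = y * (1 - c * x)\<^sup>2"
      by (simp add: frac_eq_eq)
    \<comment> \<open>The second factor could vanish only for points exchanged by the involution
      \<open>v \<mapsto> 1 / (c\<^sup>2 * v)\<close>, which moves the unit interval out of
      itself.\<close>
    then have "(x - y) * (1 - (c * x) * (c * y)) = 0"
      by (simp add: power2_eq_square algebra_simps)
    moreover have "\<bar>(c * x) * (c * y)\<bar> < 1"
      using x y cv[of x] cv[of y] abs_mult_less[of "c * x" 1 "c * y" 1] by (simp add: abs_mult)
    ultimately show "x = y"
      by auto
  qed
  have img: "g ` {0<..<1} = {0<..<1}"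
  proof (intro equalityI subsetI)
    fix y assume "y \<in> g ` {0<..<1}"
    then show "y \<in> {0<..<1}"
      using w_pos by (auto simp: g_def)
  next
    fix y :: real assume y: "y \<in> {0<..<1}"
    have "continuous_on {0..1} g"
      unfolding g_def w_def by (intro continuous_intros) (use cv in fastforce)
    \<comment> \<open>The substitution reverses orientation; the absolute value of \<open>g'\<close>
      below absorbs the sign.\<close>
    moreover have "g 0 = 1" "g 1 = 0"
      by (simp_all add: g_def w_def)
    ultimately obtain x where "0 \<le> x" "x \<le> 1" "g x = y"
      using IVT2'[of g 1 y 0] y by auto
    moreover from this have "x \<noteq> 0" "x \<noteq> 1"
      using y \<open>g 0 = 1\<close> \<open>g 1 = 0\<close> by auto
    ultimately show "y \<in> g ` {0<..<1}"
      by auto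
  qed
  have subst: "\<bar>g' v\<bar> * f (g v) = m / 2 * ((1 + c * v) / J_den (c\<^sup>2) v)"
    if v: "v \<in> {0<..<1}" for v
  proof -
    have v': "v \<in> {0..1}"
      using v by simp
    have nz: "1 - c * v > 0" "1 + c * v > 0"
      using v cv[of v] by auto
    \<comment> \<open>Here \<open>1 + v\<close> and \<open>1 + c\<^sup>2 * v\<close> appear,
      completing the factors \<open>1 - v\<close> and \<open>1 - c\<^sup>2 * v\<close> of
      \<open>w v\<close> to those under the root in \<open>J_den\<close>; the factor
      \<open>v\<close> comes from \<open>1 - w v\<close>.\<close>
    have one_minus_k: "1 - k\<^sup>2 * w v = (1 - c)\<^sup>2 * (1 + v) * (1 + c\<^sup>2 * v) / (m\<^sup>2 * (1 - c * v)\<^sup>2)"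
    proof -
      have "m\<^sup>2 * (1 - c * v)\<^sup>2 * (1 - k\<^sup>2 * w v)
          = m\<^sup>2 * (1 - c * v)\<^sup>2 - (m\<^sup>2 * k\<^sup>2) * ((1 - c * v)\<^sup>2 * w v)"
        by (simp add: algebra_simps)
      also have "m\<^sup>2 * k\<^sup>2 = (1 + c)\<^sup>2"
        unfolding k2 m(2)[symmetric] using m(1) by simp
      also have "(1 - c * v)\<^sup>2 * w v = (1 - v) * (1 - c\<^sup>2 * v)"
        using nz by (simp add: w_def)
      also have "m\<^sup>2 * (1 - c * v)\<^sup>2 - (1 + c)\<^sup>2 * ((1 - v) * (1 - c\<^sup>2 * v))
          = (1 - c)\<^sup>2 * (1 + v) * (1 + c\<^sup>2 * v)"
        unfolding m(2) by (simp add: power2_eq_square algebra_simps)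
      finally have "m\<^sup>2 * (1 - c * v)\<^sup>2 * (1 - k\<^sup>2 * w v) = (1 - c)\<^sup>2 * (1 + v) * (1 + c\<^sup>2 * v)" .
      moreover have "m\<^sup>2 * (1 - c * v)\<^sup>2 \<noteq> 0"
        using nz m(1) by simp
      ultimately show ?thesis
        by (metis nonzero_eq_divide_eq mult.commute)
    qed
    have one_minus_squares: "1 - v\<^sup>2 = (1 - v) * (1 + v)"
      "1 - (c\<^sup>2)\<^sup>2 * v\<^sup>2 = (1 - c\<^sup>2 * v) * (1 + c\<^sup>2 * v)"
      by (simp_all add: power2_eq_square algebra_simps)
    \<comment> \<open>Letters in place of the linear factors keep this a rearrangement of monomials,
      with no expansion of polynomials.\<close>
    have "A * B / h\<^sup>2 * (q * v / h\<^sup>2 * (q * C * D / (m\<^sup>2 * h\<^sup>2))) =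
        (q / (m * h ^ 3))\<^sup>2 * (v * (A * C) * (B * D))" for A B C D h q :: real
      by (simp add: power2_eq_square power3_eq_cube mult_ac)
    from this[of "1 - v" "1 - c\<^sup>2 * v" "1 - c * v" "(1 - c)\<^sup>2" "1 + v" "1 + c\<^sup>2 * v"]
    have "w v * ((1 - w v) * (1 - k\<^sup>2 * w v)) =
        ((1 - c)\<^sup>2 / (m * (1 - c * v) ^ 3))\<^sup>2 * (v * (1 - v\<^sup>2) * (1 - (c\<^sup>2)\<^sup>2 * v\<^sup>2))"
      unfolding one_minus_k one_minus_w[OF v'] one_minus_squares unfolding w_def .
    then have "sqrt (w v) * sqrt ((1 - w v) * (1 - k\<^sup>2 * w v)) =
        (1 - c)\<^sup>2 / (m * (1 - c * v) ^ 3) * J_den (c\<^sup>2) v"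
      using nz m(1) by (simp add: J_den_def real_sqrt_mult[symmetric] real_sqrt_mult[of "_\<^sup>2"])
    moreover have "\<bar>g' v\<bar> * f (g v) = (1 - c)\<^sup>2 * (1 + c * v) / (1 - c * v) ^ 3 / 2 /
        (sqrt (w v) * sqrt ((1 - w v) * (1 - k\<^sup>2 * w v)))"
      using nz w_pos[OF v] by (simp add: f_def g_def g'_def w'_def abs_mult)
    ultimately have "\<bar>g' v\<bar> * f (g v) = (1 - c)\<^sup>2 * (1 + c * v) / (1 - c * v) ^ 3 / 2 /
        ((1 - c)\<^sup>2 / (m * (1 - c * v) ^ 3) * J_den (c\<^sup>2) v)"
      by (simp only:)
    moreover have "q * p / h / 2 / (q / (m * h) * j) = m / 2 * (p / j)"
      if "q \<noteq> 0" "h \<noteq> 0" for q p h j :: real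
      using that m(1) by (simp add: field_simps)
    ultimately show ?thesis
      using nz(1) assms(1) by simp
  qed
  have "elliptic_K k = integral {0<..<1} f"
    by (simp add: elliptic_K_def f_def[abs_def] integral_open_interval_real)
  moreover have "f absolutely_integrable_on g ` {0<..<1}"
    using absolutely_integrable_elliptic_K[OF k1] by (simp add: img f_def[abs_def])
  ultimately have "(\<lambda>v. \<bar>g' v\<bar> * f (g v)) absolutely_integrable_on {0<..<1}"
    and "integral {0<..<1} (\<lambda>v. \<bar>g' v\<bar> * f (g v)) = elliptic_K k"
    using has_absolute_integral_change_of_variables_1'[of "{0<..<1}" g g' f "elliptic_K k"]
      der inj img by auto
  then have "((\<lambda>v. \<bar>g' v\<bar> * f (g v)) has_integral elliptic_K k) {0<..<1}"
    by (metis integrable_integral set_lebesgue_integral_eq_integral(1))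
  then have "((\<lambda>v. m / 2 * ((1 + c * v) / J_den (c\<^sup>2) v)) has_integral elliptic_K k) {0<..<1}"
    by (rule has_integral_eq[rotated]) (use subst in simp)
  from has_integral_mult_right[OF this, of "2 / m"] show ?thesis
    unfolding m_def[symmetric] mult.assoc[symmetric] using m(1) by simp
qed

section \<open>Lauricella functions as real integrals over the curve\<close>

text \<open>For real arguments below 1 every base \<open>1 - t * u\<close> is positive on the open
  interval, so the principal power with exponent 1/2 is the real square root.\<close>

lemma Lauricella_FD3_real:
  fixes x y z :: real
  assumes "x < 1" "y < 1" "z < 1"
    and "((\<lambda>u. u powr (\<alpha> - 1) * (1 - u) powr (\<gamma> - \<alpha> - 1) /
             sqrt ((1 - x * u) * (1 - y * u) * (1 - z * u))) has_integral I) {0<..<1}"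
  shows "Lauricella_FD3 \<alpha> (1/2) \<gamma> (of_real x) (of_real y) (of_real z) =
           of_real (Gamma \<gamma> / (Gamma \<alpha> * Gamma (\<gamma> - \<alpha>)) * I)"
proof -
  have "(1 - of_real t * of_real u) powr of_real (1/2) = (of_real (sqrt (1 - t * u)) :: complex)"
    if "t < 1" "u \<in> {0<..<1}" for t u :: real
  proof -
    have "t * u < 1 * u"
      by (rule mult_strict_right_mono) (use that in auto)
    then have "t * u \<le> 1"
      using that unfolding greaterThanLessThan_iff by linarith
    then have "of_real (1 - t * u) powr of_real (1/2) = (of_real ((1 - t * u) powr (1/2)) :: complex)"
      by (intro powr_of_real) simp
    with \<open>t * u \<le> 1\<close> show ?thesis
      by (simp add: powr_half_sqrt)
  qed
  then have "((\<lambda>u. complex_of_real (u powr (\<alpha> - 1) * (1 - u) powr (\<gamma> - \<alpha> - 1)) /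
       ((1 - of_real x * of_real u) powr of_real (1/2) *
        (1 - of_real y * of_real u) powr of_real (1/2) *
        (1 - of_real z * of_real u) powr of_real (1/2))) has_integral of_real I) {0<..<1}"
    using assms(1-3)
    by (intro has_integral_eq[OF _ has_integral_of_real[OF assms(4)]])
      (simp add: real_sqrt_mult)
  then show ?thesis
    unfolding Lauricella_FD3_def has_integral_Icc_iff_Ioo[symmetric]
    by (simp only: integral_unique of_real_mult)
qed

text \<open>The exponents stay unevaluated so that the equations match instances of
  \<open>Lauricella_FD3_real\<close> literally, for (\<alpha>, \<gamma>) equal to (1/2, 1), (3/2, 2)
  and (1/2, 2).\<close>

lemma inverse_sqrt_weight:
  fixes u :: real
  assumes "u \<in> {0<..<1}"
  shows "u powr (1/2 - 1) * (1 - u) powr (1 - 1/2 - 1) = 1 / sqrt (u * (1 - u))"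
    and "u powr (3/2 - 1) * (1 - u) powr (2 - 3/2 - 1) = u / sqrt (u * (1 - u))"
    and "u powr (1/2 - 1) * (1 - u) powr (2 - 1/2 - 1) = (1 - u) / sqrt (u * (1 - u))"
proof -
  have "t powr (1/2) = sqrt t" "t powr (- (1/2)) = 1 / sqrt t" "t / sqrt t = sqrt t"
    if "t > 0" for t :: real
    using that by (simp_all add: powr_half_sqrt powr_minus_divide real_div_sqrt)
  note * = this[of u] this[of "1 - u"]
  show "u powr (1/2 - 1) * (1 - u) powr (1 - 1/2 - 1) = 1 / sqrt (u * (1 - u))"
    using assms * by (simp add: real_sqrt_mult)
  show "u powr (3/2 - 1) * (1 - u) powr (2 - 3/2 - 1) = u / sqrt (u * (1 - u))"
    using assms * by (simp add: real_sqrt_mult)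
      (metis divide_divide_eq_left times_divide_eq_left mult.commute)
  show "u powr (1/2 - 1) * (1 - u) powr (2 - 1/2 - 1) = (1 - u) / sqrt (u * (1 - u))"
    using assms * by (simp add: real_sqrt_mult)
      (metis divide_divide_eq_left times_divide_eq_left mult.commute)
qed

lemma Gamma_three_halves_real: "Gamma (3/2 :: real) = sqrt pi / 2"
proof -
  have "(1/2 :: real) \<notin> \<int>\<^sub>\<le>\<^sub>0"
    by (auto dest: nonpos_Ints_nonpos)
  from Gamma_plus1[OF this] show ?thesis
    by (simp add: Gamma_one_half_real)
qed

text \<open>No sign conditions arise, since \<open>sqrt\<close> is multiplicative on all
  reals.\<close>

lemma J_den_at_direct:
  "sqrt (u * (1 - u)) * sqrt ((1 - (- 1) * u) * (1 - r * u) * (1 - (- r) * u)) = J_den r u"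
  unfolding J_den_def real_sqrt_mult[symmetric]
  by (rule arg_cong[where f = sqrt]) (simp add: power2_eq_square algebra_simps)

text \<open>Under \<open>v = 1 - u\<close> the zeros 2, \<open>(1 + r) / r\<close> and
  \<open>(r - 1) / r\<close> of the linear factors go to -1, \<open>- 1 / r\<close> and
  \<open>1 / r\<close>, the branch points other than 0, 1 and infinity. Normalising the factors
  costs \<open>2 * (1 - r\<^sup>2)\<close>.\<close>

lemma J_den_at_reflected:
  assumes "0 < r" "r < 1"
  shows "sqrt (u * (1 - u)) * sqrt ((1 - (1/2) * u) * (1 - (r / (1 + r)) * u) * (1 - (r / (r - 1)) * u))
           = J_den r (1 - u) / sqrt (2 * (1 - r\<^sup>2))"
proof -
  have "1 - (r / (1 + r)) * u = (1 + r * (1 - u)) / (1 + r)"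
    "1 - (r / (r - 1)) * u = (1 - r * (1 - u)) / (1 - r)"
    using assms by (simp_all add: divide_simps algebra_simps)
  moreover have "1 - (1/2) * u = (1 + (1 - u)) / 2" "1 - r\<^sup>2 = (1 + r) * (1 - r)"
    by (simp_all add: power2_eq_square algebra_simps)
  ultimately have "(1 - (1/2) * u) * (1 - (r / (1 + r)) * u) * (1 - (r / (r - 1)) * u) =
      ((1 + (1 - u)) * (1 + r * (1 - u)) * (1 - r * (1 - u))) / (2 * (1 - r\<^sup>2))"
    by (simp only: times_divide_times_eq mult.assoc)
  also have "u * (1 - u) * \<dots> =
      (1 - u) * (1 - (1 - u)\<^sup>2) * (1 - r\<^sup>2 * (1 - u)\<^sup>2) / (2 * (1 - r\<^sup>2))"
    by (simp add: power2_eq_square algebra_simps)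
  finally show ?thesis
    by (simp only: J_den_def real_sqrt_mult[symmetric] real_sqrt_divide[symmetric])
qed

lemma has_integral_reflect_unit:
  fixes f :: "real \<Rightarrow> real"
  assumes "(f has_integral I) {0<..<1}"
  shows "((\<lambda>u. f (1 - u)) has_integral I) {0<..<1}"
  using has_integral_affinity[of f I 0 1 "-1" 1] assms
  by (simp add: has_integral_Icc_iff_Ioo[symmetric])

context
  fixes r J\<^sub>0 J\<^sub>1 :: real
  assumes r: "0 < r" "r < 1"
    and J\<^sub>0: "((\<lambda>v. 1 / J_den r v) has_integral J\<^sub>0) {0<..<1}"
    and J\<^sub>1: "((\<lambda>v. v / J_den r v) has_integral J\<^sub>1) {0<..<1}"
begin

lemma Lauricella_FD3_direct:
  "Lauricella_FD3 (1/2) (1/2) 1 (- 1) (of_real r) (of_real (- r)) = of_real (J\<^sub>0 / pi)"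
  "Lauricella_FD3 (3/2) (1/2) 2 (- 1) (of_real r) (of_real (- r)) = of_real (2 * J\<^sub>1 / pi)"
proof -
  note eqs = inverse_sqrt_weight divide_divide_eq_left J_den_at_direct
  have "Lauricella_FD3 (1/2) (1/2) 1 (of_real (- 1)) (of_real r) (of_real (- r)) =
      of_real (Gamma 1 / (Gamma (1/2) * Gamma (1 - 1/2)) * J\<^sub>0)"
    by (rule Lauricella_FD3_real[OF _ _ _ has_integral_eq[OF _ J\<^sub>0]]) (use r in \<open>simp_all only: eqs\<close>)
  then show "Lauricella_FD3 (1/2) (1/2) 1 (- 1) (of_real r) (of_real (- r)) = of_real (J\<^sub>0 / pi)"
    by (simp add: Gamma_one_half_real)
  have "Lauricella_FD3 (3/2) (1/2) 2 (of_real (- 1)) (of_real r) (of_real (- r)) =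
      of_real (Gamma 2 / (Gamma (3/2) * Gamma (2 - 3/2)) * J\<^sub>1)"
    by (rule Lauricella_FD3_real[OF _ _ _ has_integral_eq[OF _ J\<^sub>1]]) (use r in \<open>simp_all only: eqs\<close>)
  then show "Lauricella_FD3 (3/2) (1/2) 2 (- 1) (of_real r) (of_real (- r)) = of_real (2 * J\<^sub>1 / pi)"
    by (simp add: Gamma_one_half_real Gamma_three_halves_real Gamma_numeral)
qed

text \<open>For \<gamma> = 2 the weight has numerator \<open>1 - u\<close>, which is
  \<open>v\<close> after reflection; hence \<open>J\<^sub>1\<close>, although \<alpha> is still
  1/2.\<close>

lemma Lauricella_FD3_reflected:
  "Lauricella_FD3 (1/2) (1/2) 1 (1/2) (of_real (r / (1 + r))) (of_real (r / (r - 1))) =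
     of_real (sqrt (2 * (1 - r\<^sup>2)) * J\<^sub>0 / pi)"
  "Lauricella_FD3 (1/2) (1/2) 2 (1/2) (of_real (r / (1 + r))) (of_real (r / (r - 1))) =
     of_real (2 * sqrt (2 * (1 - r\<^sup>2)) * J\<^sub>1 / pi)"
proof -
  note eqs = inverse_sqrt_weight divide_divide_eq_left J_den_at_reflected[OF r]
  note J\<^sub>0' = has_integral_reflect_unit[OF J\<^sub>0, THEN has_integral_mult_right[of _ _ _ "sqrt (2 * (1 - r\<^sup>2))"]]
  note J\<^sub>1' = has_integral_reflect_unit[OF J\<^sub>1, THEN has_integral_mult_right[of _ _ _ "sqrt (2 * (1 - r\<^sup>2))"]]
  have lt: "r / (1 + r) < 1" "r / (r - 1) < 1"
    using r by (simp_all add: divide_simps)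
  have "Lauricella_FD3 (1/2) (1/2) 1 (of_real (1/2)) (of_real (r / (1 + r))) (of_real (r / (r - 1))) =
      of_real (Gamma 1 / (Gamma (1/2) * Gamma (1 - 1/2)) * (sqrt (2 * (1 - r\<^sup>2)) * J\<^sub>0))"
    by (rule Lauricella_FD3_real[OF _ lt has_integral_eq[OF _ J\<^sub>0']]) (simp_all only: eqs, simp_all)
  then show "Lauricella_FD3 (1/2) (1/2) 1 (1/2) (of_real (r / (1 + r))) (of_real (r / (r - 1))) =
     of_real (sqrt (2 * (1 - r\<^sup>2)) * J\<^sub>0 / pi)"
    by (simp add: Gamma_one_half_real)
  have "Lauricella_FD3 (1/2) (1/2) 2 (of_real (1/2)) (of_real (r / (1 + r))) (of_real (r / (r - 1))) =
      of_real (Gamma 2 / (Gamma (1/2) * Gamma (2 - 1/2)) * (sqrt (2 * (1 - r\<^sup>2)) * J\<^sub>1))"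
    by (rule Lauricella_FD3_real[OF _ lt has_integral_eq[OF _ J\<^sub>1']]) (simp_all only: eqs, simp_all)
  then show "Lauricella_FD3 (1/2) (1/2) 2 (1/2) (of_real (r / (1 + r))) (of_real (r / (r - 1))) =
     of_real (2 * sqrt (2 * (1 - r\<^sup>2)) * J\<^sub>1 / pi)"
    by (simp add: Gamma_one_half_real Gamma_three_halves_real Gamma_numeral)
qed

end

section \<open>Both quotients reduced to the two elliptic periods\<close>

theorem mainTheorem3:
  fixes a b :: real
  assumes "a > b" and "b > 0"
  shows
    "complex_of_real (K_plus a b / K_minus a b) =
      (complex_of_real (sqrt b / 2) *
         Lauricella_FD3 (1/2) (1/2) 2 (1/2) (complex_of_real (b / (a + b))) (complex_of_real (b / (b - a)))
       + complex_of_real (sqrt a) *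
         Lauricella_FD3 (1/2) (1/2) 1 (1/2) (complex_of_real (b / (a + b))) (complex_of_real (b / (b - a))))
      / (complex_of_real (sqrt a) *
         Lauricella_FD3 (1/2) (1/2) 1 (1/2) (complex_of_real (b / (a + b))) (complex_of_real (b / (b - a)))
       - complex_of_real (sqrt b / 2) *
         Lauricella_FD3 (1/2) (1/2) 2 (1/2) (complex_of_real (b / (a + b))) (complex_of_real (b / (b - a))))
     \<and>
     complex_of_real (K_plus a b / K_minus a b) =
      (complex_of_real (2 * sqrt (a * (a + b))) *
         Lauricella_FD3 (1/2) (1/2) 1 (- 1) (complex_of_real (b / a)) (complex_of_real (- (b / a)))
       + complex_of_real (sqrt (b * (a + b))) *
         Lauricella_FD3 (3/2) (1/2) 2 (- 1) (complex_of_real (b / a)) (complex_of_real (- (b / a))))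
      / (complex_of_real (2 * sqrt (a * (a + b))) *
         Lauricella_FD3 (1/2) (1/2) 1 (- 1) (complex_of_real (b / a)) (complex_of_real (- (b / a)))
       - complex_of_real (sqrt (b * (a + b))) *
         Lauricella_FD3 (3/2) (1/2) 2 (- 1) (complex_of_real (b / a)) (complex_of_real (- (b / a))))"
proof -
  define c where "c = sqrt b / sqrt a"
  define r where "r = b / a"
  \<comment> \<open>The constant of \<open>elliptic_K_quintic\<close>: even in \<open>c\<close>, so
    both signs share it and it cancels in the ratio.\<close>
  define \<kappa> where "\<kappa> = 2 / sqrt (2 * (1 + c\<^sup>2))"
  \<comment> \<open>These values solve
    \<open>J\<^sub>0 + c * J\<^sub>1 = \<kappa> * K_plus a b\<close> and
    \<open>J\<^sub>0 - c * J\<^sub>1 = \<kappa> * K_minus a b\<close>; that they are the integrals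
    follows from \<open>plus\<close> and \<open>minus\<close>.\<close>
  define J\<^sub>0 where "J\<^sub>0 = \<kappa> * (K_plus a b + K_minus a b) / 2"
  define J\<^sub>1 where "J\<^sub>1 = \<kappa> * (K_plus a b - K_minus a b) / (2 * c)"
  have a: "a > 0"
    using assms by simp
  have r: "0 < r" "r < 1"
    using assms by (simp_all add: r_def)
  have c: "0 < c" "c < 1" "c\<^sup>2 = r"
    using assms by (simp_all add: c_def r_def power_divide)
  have "\<kappa> > 0"
    by (simp add: \<kappa>_def add_pos_nonneg)
  \<comment> \<open>Dividing numerator and denominator of each modulus by \<open>sqrt a\<close>
    leaves an expression in \<open>c\<close> alone.\<close>
  have "2 * (a + b) = (sqrt a)\<^sup>2 * (2 * (1 + c\<^sup>2))"
    using assms a c by (simp add: r_def field_simps)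
  then have sqrt_sum: "sqrt (2 * (a + b)) = sqrt a * sqrt (2 * (1 + c\<^sup>2))"
    using a by (simp only: real_sqrt_mult) simp
  have K: "elliptic_K ((1 + c) / sqrt (2 * (1 + c\<^sup>2))) = K_plus a b"
    "elliptic_K ((1 - c) / sqrt (2 * (1 + c\<^sup>2))) = K_minus a b"
    unfolding K_plus_def K_minus_def sqrt_sum using a
    by (simp_all add: c_def add_divide_distrib diff_divide_distrib flip: divide_divide_eq_left)
  have plus: "((\<lambda>v. (1 + c * v) / J_den r v) has_integral \<kappa> * K_plus a b) {0<..<1}"
    using elliptic_K_quintic[of c] K c by (simp add: \<kappa>_def)
  have minus: "((\<lambda>v. (1 - c * v) / J_den r v) has_integral \<kappa> * K_minus a b) {0<..<1}"
    using elliptic_K_quintic[of "- c"] K c by (simp add: \<kappa>_def)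
  have J\<^sub>0: "((\<lambda>v. 1 / J_den r v) has_integral J\<^sub>0) {0<..<1}"
    using has_integral_mult_right[OF has_integral_add[OF plus minus], of "1/2"]
    by (simp add: J\<^sub>0_def ring_distribs flip: add_divide_distrib)
  have J\<^sub>1: "((\<lambda>v. v / J_den r v) has_integral J\<^sub>1) {0<..<1}"
    using has_integral_mult_right[OF has_integral_diff[OF plus minus], of "1 / (2 * c)"] c
    by (simp add: J\<^sub>1_def right_diff_distrib flip: diff_divide_distrib)
  have args: "b / (a + b) = r / (1 + r)" "b / (b - a) = r / (r - 1)" "b / a = r"
    using assms a by (simp_all add: r_def divide_simps)
  have FD:
    "Lauricella_FD3 (1/2) (1/2) 1 (- 1) (of_real (b / a)) (of_real (- (b / a))) = of_real (J\<^sub>0 / pi)"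
    "Lauricella_FD3 (3/2) (1/2) 2 (- 1) (of_real (b / a)) (of_real (- (b / a))) = of_real (2 * J\<^sub>1 / pi)"
    "Lauricella_FD3 (1/2) (1/2) 1 (1/2) (of_real (b / (a + b))) (of_real (b / (b - a))) =
       of_real (sqrt (2 * (1 - r\<^sup>2)) * J\<^sub>0 / pi)"
    "Lauricella_FD3 (1/2) (1/2) 2 (1/2) (of_real (b / (a + b))) (of_real (b / (b - a))) =
       of_real (2 * sqrt (2 * (1 - r\<^sup>2)) * J\<^sub>1 / pi)"
    unfolding args
    by (rule Lauricella_FD3_direct[OF r J\<^sub>0 J\<^sub>1] Lauricella_FD3_reflected[OF r J\<^sub>0 J\<^sub>1])+
  have J: "J\<^sub>0 + c * J\<^sub>1 = \<kappa> * K_plus a b" "J\<^sub>0 - c * J\<^sub>1 = \<kappa> * K_minus a b"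
    using c by (simp_all add: J\<^sub>0_def J\<^sub>1_def field_simps)
  have ratio: "K_plus a b / K_minus a b = N / D"
    if "d > 0" "N = d * (J\<^sub>0 + c * J\<^sub>1)" "D = d * (J\<^sub>0 - c * J\<^sub>1)" for d N D
    using that \<open>\<kappa> > 0\<close> by (simp add: J)
  have sqrt_b: "sqrt b = c * sqrt a" "sqrt (b * (a + b)) = c * sqrt (a * (a + b))"
    using a by (simp_all add: c_def real_sqrt_mult)
  show ?thesis
  proof
    \<comment> \<open>This is the common factor \<open>d\<close> for \<open>ratio\<close>: the
      coefficient \<open>sqrt b / 2\<close> cancels the 2 in front of \<open>J\<^sub>1\<close>, and
      \<open>sqrt b = c * sqrt a\<close> supplies the \<open>c\<close>.\<close>
    have "0 < sqrt a * sqrt (2 * (1 - r\<^sup>2)) / pi"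
      using a r by (simp add: power_less_one_iff)
    then show "complex_of_real (K_plus a b / K_minus a b) =
      (complex_of_real (sqrt b / 2) *
         Lauricella_FD3 (1/2) (1/2) 2 (1/2) (complex_of_real (b / (a + b))) (complex_of_real (b / (b - a)))
       + complex_of_real (sqrt a) *
         Lauricella_FD3 (1/2) (1/2) 1 (1/2) (complex_of_real (b / (a + b))) (complex_of_real (b / (b - a))))
      / (complex_of_real (sqrt a) *
         Lauricella_FD3 (1/2) (1/2) 1 (1/2) (complex_of_real (b / (a + b))) (complex_of_real (b / (b - a)))
       - complex_of_real (sqrt b / 2) *
         Lauricella_FD3 (1/2) (1/2) 2 (1/2) (complex_of_real (b / (a + b))) (complex_of_real (b / (b - a))))"
      unfolding FD of_real_mult[symmetric] of_real_add[symmetric] of_real_diff[symmetric]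
        of_real_divide[symmetric] of_real_eq_iff sqrt_b
      by (rule ratio) (simp_all add: field_simps)
    \<comment> \<open>Again the factor \<open>d\<close>; here the 2 comes from the coefficient of
      the \<open>J\<^sub>0\<close> term and from the value
      \<open>2 * J\<^sub>1 / pi\<close>.\<close>
    have "0 < 2 * sqrt (a * (a + b)) / pi"
      using a assms by simp
    then show "complex_of_real (K_plus a b / K_minus a b) =
      (complex_of_real (2 * sqrt (a * (a + b))) *
         Lauricella_FD3 (1/2) (1/2) 1 (- 1) (complex_of_real (b / a)) (complex_of_real (- (b / a)))
       + complex_of_real (sqrt (b * (a + b))) *
         Lauricella_FD3 (3/2) (1/2) 2 (- 1) (complex_of_real (b / a)) (complex_of_real (- (b / a))))
      / (complex_of_real (2 * sqrt (a * (a + b))) *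
         Lauricella_FD3 (1/2) (1/2) 1 (- 1) (complex_of_real (b / a)) (complex_of_real (- (b / a)))
       - complex_of_real (sqrt (b * (a + b))) *
         Lauricella_FD3 (3/2) (1/2) 2 (- 1) (complex_of_real (b / a)) (complex_of_real (- (b / a))))"
      unfolding FD of_real_mult[symmetric] of_real_add[symmetric] of_real_diff[symmetric]
        of_real_divide[symmetric] of_real_eq_iff sqrt_b
      by (rule ratio) (simp_all add: field_simps)
  qed
qed

end
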